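(* Let $n\geq 2$ be an integer, let $A$ be a non-empty subset of $\mathbb Z_n'$, and let $S$ be a sequence in $\mathbb Z_n$. Then $S$ is an $E$-extremal sequence for $(A,\mathbb Z_n')$ if and only if $S$ is an $E$-extremal sequence for $A$.
   Context: $\mathbb Z_n=\mathbb Z/n\mathbb Z$ as a module over itself and $\mathbb Z_n'=\mathbb Z_n\setminus\{0\}$. A subsequence is a non-empty subfamily of terms in the original order. A sequence $(x_1,\ldots,x_k)$ is an $A$-weighted zero-sum sequence if there exist $a_i\in A$ with $\sum a_ix_i=0$, and an $(A,B)$-weighted zero-sum sequence if there exist $a_i\in A$, $b_i\in B$ with $\sum a_ix_i=0$ and $\sum b_ia_i=0$. $E_{A,B}(n)$ (resp. $E_A(n)$) is the least positive $k$ such that every sequence of length $k$ in $\mathbb Z_n$ has an $(A,B)$-weighted (resp. $A$-weighted) zero-sum subsequence of length $n$. An $E$-extremal sequence for $(A,B)$ (resp. for $A$) is a sequence of length $E_{A,B}(n)-1$ (resp. $E_A(n)-1$) having no $(A,B)$-weighted (resp. $A$-weighted) zero-sum subsequence of length $n$. *)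

theory Defs
  imports "HOL-Number_Theory.Residues" "HOL-Library.Sublist"
begin

abbreviation Zn :: "nat \<Rightarrow> int ring"
  where "Zn n \<equiv> residue_ring (int n)"

definition Zn' :: "nat \<Rightarrow> int set"
  where "Zn' n = carrier (Zn n) - {\<zero>\<^bsub>Zn n\<^esub>}"

definition subsequence :: "'a list \<Rightarrow> 'a list \<Rightarrow> bool"
  where "subsequence T S \<longleftrightarrow> T \<noteq> [] \<and> subseq T S"

text \<open>
  Families of weights are functions on \<open>nat\<close>, only relevant on the indices of the sequence.
  The sums are finite sums in the ring \<open>Zn n\<close>, so \<open>A\<close>, \<open>B\<close> and the terms of
  the sequence are meant to lie in its carrier.
\<close>

definition weighted_zero_sum :: "nat \<Rightarrow> int set \<Rightarrow> int list \<Rightarrow> bool"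
  where "weighted_zero_sum n A xs \<longleftrightarrow>
    (\<exists>a :: nat \<Rightarrow> int.
      (\<forall>i<length xs. a i \<in> A) \<and>
      (\<Oplus>\<^bsub>Zn n\<^esub>i\<in>{..<length xs}. a i \<otimes>\<^bsub>Zn n\<^esub> xs ! i) = \<zero>\<^bsub>Zn n\<^esub>)"

definition weighted_zero_sum2 :: "nat \<Rightarrow> int set \<Rightarrow> int set \<Rightarrow> int list \<Rightarrow> bool"
  where "weighted_zero_sum2 n A B xs \<longleftrightarrow>
    (\<exists>(a :: nat \<Rightarrow> int) (b :: nat \<Rightarrow> int).
      (\<forall>i<length xs. a i \<in> A) \<and> (\<forall>i<length xs. b i \<in> B) \<and>
      (\<Oplus>\<^bsub>Zn n\<^esub>i\<in>{..<length xs}. a i \<otimes>\<^bsub>Zn n\<^esub> xs ! i) = \<zero>\<^bsub>Zn n\<^esub> \<and>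
      (\<Oplus>\<^bsub>Zn n\<^esub>i\<in>{..<length xs}. b i \<otimes>\<^bsub>Zn n\<^esub> a i) = \<zero>\<^bsub>Zn n\<^esub>)"

definition E_const :: "nat \<Rightarrow> int set \<Rightarrow> nat"
  where "E_const n A =
    (LEAST k. 0 < k \<and>
      (\<forall>S. set S \<subseteq> carrier (Zn n) \<and> length S = k \<longrightarrow>
        (\<exists>T. subsequence T S \<and> length T = n \<and> weighted_zero_sum n A T)))"

text \<open>
  For some \<open>B\<close> (for instance the empty set) no such \<open>k\<close> exists and the value of the
  following constant is unspecified.  For non-empty \<open>A\<close> and \<open>B = Zn' n\<close> with \<open>n \<ge> 2\<close> it does exist:
  by the pigeonhole principle a long sequence has \<open>n\<close> equal terms, and constant weights work for
  these.  The same applies to \<open>E_const n A\<close>.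
\<close>

definition E_const2 :: "nat \<Rightarrow> int set \<Rightarrow> int set \<Rightarrow> nat"
  where "E_const2 n A B =
    (LEAST k. 0 < k \<and>
      (\<forall>S. set S \<subseteq> carrier (Zn n) \<and> length S = k \<longrightarrow>
        (\<exists>T. subsequence T S \<and> length T = n \<and> weighted_zero_sum2 n A B T)))"

definition E_extremal :: "nat \<Rightarrow> int set \<Rightarrow> int list \<Rightarrow> bool"
  where "E_extremal n A S \<longleftrightarrow>
    set S \<subseteq> carrier (Zn n) \<and> length S = E_const n A - 1 \<and>
    \<not> (\<exists>T. subsequence T S \<and> length T = n \<and> weighted_zero_sum n A T)"

definition E_extremal2 :: "nat \<Rightarrow> int set \<Rightarrow> int set \<Rightarrow> int list \<Rightarrow> bool"
  where "E_extremal2 n A B S \<longleftrightarrow>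
    set S \<subseteq> carrier (Zn n) \<and> length S = E_const2 n A B - 1 \<and>
    \<not> (\<exists>T. subsequence T S \<and> length T = n \<and> weighted_zero_sum2 n A B T)"

end

theory Submission imports Defs begin

text \<open>
  It suffices that every family of \<open>n\<close> nonzero elements \<open>a i\<close> of \<open>\<int>\<^sub>n\<close> satisfies
  \<open>\<Sum> b i * a i = 0\<close> for suitable nonzero \<open>b i\<close>: then the condition on the \<open>b i\<close> in the
  definition of an \<open>(A, \<int>\<^sub>n')\<close>-weighted zero-sum sequence is vacuous for length \<open>n\<close>.
  For \<open>n = 2\<close> all \<open>b i = 1\<close> work.  For \<open>n \<ge> 3\<close>, the nonzero multiples of a single \<open>a i\<close> are all
  nonzero elements if \<open>a i\<close> is a unit, and include \<open>0\<close> otherwise; in both cases they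
  include the nonzero element \<open>a i\<close>.  The sumset of two sets of this kind contains \<open>0\<close> and a
  nonzero element, so the property propagates by induction on the number of terms.
\<close>

text \<open>Integer arithmetic on representatives; \<open>finsum_Zn\<close> and
  \<open>Zn'_eq\<close> translate from the ring \<open>Zn n\<close>.\<close>

definition nonzero_comb :: "int \<Rightarrow> ('i \<Rightarrow> int) \<Rightarrow> 'i set \<Rightarrow> int set"
  where "nonzero_comb N a I = {(\<Sum>i\<in>I. b i * a i) mod N | b. \<forall>i\<in>I. b i \<in> {1..<N}}"

text \<open>The invariant of the induction. The second alternative covers the nonzero multiples of a
  single unit, which omit 0.\<close>

definition spread :: "int \<Rightarrow> int set \<Rightarrow> bool"
  where "spread N X \<longleftrightarrow> X \<inter> {1..<N} \<noteq> {} \<and> (0 \<in> X \<or> {1..<N} \<subseteq> X)"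

lemma nonzero_comb_insert:
  assumes "finite I" "j \<notin> I" "x \<in> nonzero_comb N a I" "y \<in> nonzero_comb N a {j}"
  shows "(x + y) mod N \<in> nonzero_comb N a (insert j I)"
proof -
  obtain b where b: "\<forall>i\<in>I. b i \<in> {1..<N}" "x = (\<Sum>i\<in>I. b i * a i) mod N"
    using assms(3) by (auto simp: nonzero_comb_def)
  obtain c where c: "c \<in> {1..<N}" "y = c * a j mod N"
    using assms(4) by (auto simp: nonzero_comb_def)
  have "(\<Sum>i\<in>I. (b(j := c)) i * a i) = (\<Sum>i\<in>I. b i * a i)"
    using assms(2) by (intro sum.cong) auto
  then have "(\<Sum>i\<in>insert j I. (b(j := c)) i * a i) mod N = (x + y) mod N"
    using assms(1,2) b(2) c(2) by (simp add: mod_simps add.commute)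
  then show ?thesis
    unfolding nonzero_comb_def using b(1) c(1)
    by (intro CollectI exI[of _ "b(j := c)"]) auto
qed

text \<open>The sum 0 arises as 0 + 0, or as a nonzero element plus its negative from a full set. A
  nonzero sum arises by adding 0 to a nonzero element, or from two full sets as 1 + 1, where
  \<open>N \<ge> 3\<close> enters.\<close>

lemma spread_sumset:
  assumes "N \<ge> 3" "spread N X" "spread N Y" and Z: "\<And>x y. x \<in> X \<Longrightarrow> y \<in> Y \<Longrightarrow> (x + y) mod N \<in> Z"
  shows "0 \<in> Z" "spread N Z"
proof -
  obtain x where x: "x \<in> X" "x \<in> {1..<N}" using assms(2) unfolding spread_def by blast
  obtain y where y: "y \<in> Y" "y \<in> {1..<N}" using assms(3) unfolding spread_def by blast
  consider "{1..<N} \<subseteq> X" "{1..<N} \<subseteq> Y" | "{1..<N} \<subseteq> X" "0 \<in> Y" | "0 \<in> X" "{1..<N} \<subseteq> Y" | "0 \<in> X" "0 \<in> Y"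
    using assms(2,3) by (auto simp: spread_def)
  then have "0 \<in> Z \<and> Z \<inter> {1..<N} \<noteq> {}"
  proof cases
    case 1
    then have "1 \<in> X" "N - 1 \<in> Y" "1 \<in> Y" using assms(1) by auto
    then show ?thesis using Z[of 1 "N - 1"] Z[of 1 1] assms(1) by auto
  next
    case 2
    then have "N - y \<in> X" using y by auto
    then show ?thesis using Z[of "N - y" y] Z[of x 0] x y 2 by auto
  next
    case 3
    then have "N - x \<in> Y" using x by auto
    then show ?thesis using Z[of x "N - x"] Z[of 0 y] x y 3 by auto
  next
    case 4
    then show ?thesis using Z[of 0 0] Z[of x 0] x by auto
  qed
  then show "0 \<in> Z" "spread N Z" by (auto simp: spread_def)
qed

lemma spread_nonzero_comb_singleton:
  assumes "a j \<in> {1..<N}"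
  shows "spread N (nonzero_comb N a {j})"
proof -
  have comb: "c * a j mod N \<in> nonzero_comb N a {j}" if "c \<in> {1..<N}" for c
    using that by (auto simp: nonzero_comb_def intro!: exI[of _ "\<lambda>_. c"])
  have "a j \<in> nonzero_comb N a {j}" using comb[of 1] assms by auto
  moreover have "0 \<in> nonzero_comb N a {j} \<or> {1..<N} \<subseteq> nonzero_comb N a {j}"
  proof (cases "coprime (a j) N")
    case True
    then obtain u where u: "[a j * u = 1] (mod N)" using coprime_iff_invertible_int by blast
    have "x \<in> nonzero_comb N a {j}" if x: "x \<in> {1..<N}" for x
    proof -
      define c where "c = x * u mod N"
      have "[c * a j = x * (a j * u)] (mod N)"
        by (simp add: c_def cong_def mod_simps algebra_simps)
      also have "[x * (a j * u) = x * 1] (mod N)" using u by (intro cong_mult cong_refl)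
      finally have eq: "c * a j mod N = x" using x by (simp add: cong_def)
      then have "c \<noteq> 0" using x by auto
      moreover have "0 \<le> c" "c < N" using x by (auto simp: c_def)
      ultimately show ?thesis using comb[of c] eq by auto
    qed
    then show ?thesis by blast
  next
    case False
    define d where "d = gcd (a j) N"
    have "d \<ge> 0" "d \<noteq> 0" "d \<noteq> 1" using False assms by (auto simp: d_def coprime_iff_gcd_eq_1)
    then have "d > 1" by linarith
    \<comment> \<open>The multiplier \<open>k = N / d\<close> is below \<open>N\<close> as
      \<open>d > 1\<close>, and annihilates \<open>a j\<close> modulo \<open>N\<close> because
      \<open>d\<close> divides \<open>a j\<close>.\<close>
    obtain k where k: "N = d * k" using d_def by (meson dvdE gcd_dvd2)
    obtain l where l: "a j = d * l" using d_def by (meson dvdE gcd_dvd1)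
    have "k > 0" using k assms \<open>d > 1\<close> zero_less_mult_pos[of d k] by simp
    then have "k < N" using k \<open>d > 1\<close> by simp
    moreover have "k * a j = N * l" by (simp add: k l)
    ultimately show ?thesis using comb[of k] \<open>k > 0\<close> by auto
  qed
  ultimately show ?thesis using assms by (auto simp: spread_def)
qed

text \<open>One term is kept apart because \<open>spread\<close> alone does not give 0, as a single
  unit shows; a sumset of two spread sets does.\<close>

lemma zero_in_nonzero_comb_insert:
  assumes "N \<ge> 3" "finite I" "I \<noteq> {}" "j \<notin> I" "\<forall>i\<in>insert j I. a i \<in> {1..<N}"
  shows "0 \<in> nonzero_comb N a (insert j I)"
proof -
  have "spread N (nonzero_comb N a I)" using assms(2,3,5)
  proof (induction I rule: finite_ne_induct)
    case (singleton i)
    then show ?case by (simp add: spread_nonzero_comb_singleton)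
  next
    case (insert i I)
    then show ?case
      using spread_sumset(2)[OF assms(1) _ spread_nonzero_comb_singleton[of a i N]]
        nonzero_comb_insert[of I i] by simp
  qed
  then show ?thesis
    using spread_sumset(1)[OF assms(1) _ spread_nonzero_comb_singleton[of a j N]]
      nonzero_comb_insert[OF assms(2,4)] assms(5) by simp
qed

lemma zero_in_nonzero_comb:
  assumes "n \<ge> 2" "\<forall>i<n. a i \<in> {1..<int n}"
  shows "0 \<in> nonzero_comb (int n) a {..<n}"
proof (cases "n = 2")
  \<comment> \<open>Modulo 2 the sumset argument breaks down, since 1 + 1 = 0; here the sum vanishes
    because there are exactly two terms.\<close>
  case True
  then have "a 0 = 1" "a 1 = 1" using assms(2)[rule_format, of 0] assms(2)[rule_format, of 1] by auto
  then show ?thesis using True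
    by (auto simp: nonzero_comb_def numeral_2_eq_2 lessThan_Suc intro!: exI[of _ "\<lambda>_. 1"])
next
  case False
  obtain m where m: "n = Suc m" using assms(1) by (cases n) auto
  show ?thesis
    using zero_in_nonzero_comb_insert[of "int n" "{..<m}" m a] assms False
    by (auto simp: m lessThan_Suc lessThan_empty_iff)
qed

lemma finsum_Zn:
  assumes "n \<ge> 2" "finite I"
  shows "(\<Oplus>\<^bsub>Zn n\<^esub>i\<in>I. b i \<otimes>\<^bsub>Zn n\<^esub> a i) = (\<Sum>i\<in>I. b i * a i) mod int n"
proof -
  interpret residues "int n" "Zn n"
    using assms(1) by unfold_locales simp_all
  show ?thesis using assms(2)
  proof (induction I rule: finite_induct)
    case empty
    then show ?case by (simp add: res_zero_eq)
  next
    case (insert i I)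
    then show ?case
      using assms(1)
      \<comment> \<open>Multiplication in \<open>Zn n\<close> reduces modulo \<open>n\<close>, so
        every summand lies in the carrier, as \<open>finsum_insert\<close> demands.\<close>
      by (subst finsum_insert) (auto simp: res_mult_eq res_add_eq res_carrier_eq mod_simps)
  qed
qed

lemma Zn'_eq:
  assumes "n \<ge> 2"
  shows "Zn' n = {1..<int n}"
proof -
  interpret residues "int n" "Zn n"
    using assms by unfold_locales simp_all
  show ?thesis by (auto simp: Zn'_def res_carrier_eq res_zero_eq)
qed

text \<open>The second equation involves only the weights \<open>a\<close>, so \<open>b\<close> can
  be chosen after them. The length matters: a single unit weight has no nonzero annihilator.\<close>

lemma weighted_zero_sum2_Zn'_iff:
  assumes "n \<ge> 2" "A \<subseteq> Zn' n" "length T = n"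
  shows "weighted_zero_sum2 n A (Zn' n) T \<longleftrightarrow> weighted_zero_sum n A T"
proof
  assume "weighted_zero_sum2 n A (Zn' n) T"
  then show "weighted_zero_sum n A T"
    unfolding weighted_zero_sum2_def weighted_zero_sum_def by blast
next
  assume "weighted_zero_sum n A T"
  then obtain a where a: "\<forall>i<length T. a i \<in> A"
      "(\<Oplus>\<^bsub>Zn n\<^esub>i\<in>{..<length T}. a i \<otimes>\<^bsub>Zn n\<^esub> T ! i) = \<zero>\<^bsub>Zn n\<^esub>"
    unfolding weighted_zero_sum_def by blast
  have "\<forall>i<n. a i \<in> {1..<int n}" using a(1) assms(2,3) Zn'_eq[OF assms(1)] by blast
  then have "0 \<in> nonzero_comb (int n) a {..<n}" using zero_in_nonzero_comb assms(1) by blast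
  then obtain b where "\<forall>i\<in>{..<n}. b i \<in> {1..<int n}" "0 = (\<Sum>i<n. b i * a i) mod int n"
    unfolding nonzero_comb_def by blast
  then have b: "\<forall>i<n. b i \<in> Zn' n" "(\<Sum>i<n. b i * a i) mod int n = 0"
    by (simp_all add: Zn'_eq[OF assms(1)])
  have "(\<Oplus>\<^bsub>Zn n\<^esub>i\<in>{..<length T}. b i \<otimes>\<^bsub>Zn n\<^esub> a i) = \<zero>\<^bsub>Zn n\<^esub>"
    using b(2) assms(3) finsum_Zn[OF assms(1), of "{..<n}" b a]
    by (simp add: residue_ring_def)
  with a b(1) assms(3) show "weighted_zero_sum2 n A (Zn' n) T"
    unfolding weighted_zero_sum2_def by blast
qed

theorem theorem22:
  fixes n :: nat and A :: "int set" and S :: "int list"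
  assumes "n \<ge> 2"
    and "A \<noteq> {}" and "A \<subseteq> Zn' n"
    and "set S \<subseteq> carrier (Zn n)"
  shows "E_extremal2 n A (Zn' n) S \<longleftrightarrow> E_extremal n A S"
proof -
  \<comment> \<open>Stated for every \<open>S\<close>, so that it also rewrites under
    \<open>LEAST\<close> and identifies the two constants.\<close>
  have iff: "(\<exists>T. subsequence T S \<and> length T = n \<and> weighted_zero_sum2 n A (Zn' n) T) \<longleftrightarrow>
      (\<exists>T. subsequence T S \<and> length T = n \<and> weighted_zero_sum n A T)" for S
    using weighted_zero_sum2_Zn'_iff[OF assms(1,3)] by blast
  show ?thesis
    unfolding E_extremal2_def E_extremal_def E_const2_def E_const_def iff ..
qed

end
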